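(* Consider the online general knapsack problem with reservation in which the reservation cost of an item is proportional to its size, with reservation factor $0<\alpha\le 1$. For no constant $c<2$ is there an online algorithm $\mathtt{A}$ that is $c$-competitive in the non-strict sense; that is, for every online algorithm $\mathtt{A}$, every $c<2$ and every constant $\beta>0$ there is a request sequence $S$ with ${\rm gain}_{\mathtt{OPT}}(S)> c\cdot {\rm gain}_{\mathtt{A}}(S)+\beta$.
   Context: Online general knapsack with reservation: the knapsack has capacity $1$. Items $x=(s_x,v_x)$ with size $0<s_x\le 1$ and value $v_x> 0$ arrive one by one. When an item arrives, a (deterministic) online algorithm must immediately and irrevocably either pack it, reject it, or reserve it. After the whole sequence has arrived, the algorithm may pack any subset of the reserved items that fits into the knapsack together with the already packed items (total size at most $1$). Every reserved item incurs a reservation cost, paid regardless of whether the item is finally packed; here the cost of reserving $x$ is $\alpha\cdot s_x$. The gain of an algorithm on a sequence $S$ is the total value of packed items minus the total reservation costs; ${\rm gain}_{\mathtt{OPT}}(S)$ is the maximum total value of a subset of items of $S$ of total size at most $1$. *)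

theory Defs
  imports Complex_Main
begin

datatype item = Item (item_size: real) (item_value: real)

datatype decision = Pack | Reject | Reserve

definition request_sequence :: "item list \<Rightarrow> bool" where
  "request_sequence S \<longleftrightarrow>
     (\<forall>x \<in> set S. 0 < item_size x \<and> item_size x \<le> 1 \<and> 0 < item_value x)"

text \<open>
  Sub-collections of a request sequence are sets of positions, so that several
  requests with the same size and value remain distinct items.
\<close>

definition total_size :: "item list \<Rightarrow> nat set \<Rightarrow> real" where
  "total_size S I = (\<Sum>i\<in>I. item_size (S ! i))"

definition total_value :: "item list \<Rightarrow> nat set \<Rightarrow> real" where
  "total_value S I = (\<Sum>i\<in>I. item_value (S ! i))"

definition opt_gain :: "item list \<Rightarrow> real" where
  "opt_gain S = Max {total_value S I | I. I \<subseteq> {..<length S} \<and> total_size S I \<le> 1}"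

text \<open>
  \<open>decide A\<close> receives the requests seen so far, the last of which is the item to
  be decided upon; as the algorithm is deterministic, its earlier decisions are
  determined by the same list. \<open>finish A\<close> receives the whole sequence and returns
  the positions of the reserved items that are packed at the end.
\<close>

record algorithm =
  decide :: "item list \<Rightarrow> decision"
  finish :: "item list \<Rightarrow> nat set"

definition positions :: "decision \<Rightarrow> algorithm \<Rightarrow> item list \<Rightarrow> nat set" where
  "positions d A S = {i. i < length S \<and> decide A (take (Suc i) S) = d}"

abbreviation packed :: "algorithm \<Rightarrow> item list \<Rightarrow> nat set" where
  "packed \<equiv> positions Pack"

abbreviation reserved :: "algorithm \<Rightarrow> item list \<Rightarrow> nat set" where
  "reserved \<equiv> positions Reserve"

text \<open>
  Every prefix of a request sequence is itself a request sequence, so the capacity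
  bound is imposed at every point in time.
\<close>

definition online_algorithm :: "algorithm \<Rightarrow> bool" where
  "online_algorithm A \<longleftrightarrow>
     (\<forall>S. request_sequence S \<longrightarrow>
        finish A S \<subseteq> reserved A S \<and>
        total_size S (packed A S \<union> finish A S) \<le> 1)"

definition gain :: "real \<Rightarrow> algorithm \<Rightarrow> item list \<Rightarrow> real" where
  "gain \<alpha> A S =
     total_value S (packed A S \<union> finish A S) - (\<Sum>i\<in>reserved A S. \<alpha> * item_size (S ! i))"

definition nonstrictly_competitive :: "real \<Rightarrow> real \<Rightarrow> algorithm \<Rightarrow> bool" where
  "nonstrictly_competitive \<alpha> c A \<longleftrightarrow>
     (\<exists>\<beta>>0. \<forall>S. request_sequence S \<longrightarrow> opt_gain S \<le> c * gain \<alpha> A S + \<beta>)"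

end

theory Submission imports Defs begin

text \<open>
  Offer items of equal value \<open>V\<close> and strictly decreasing sizes above \<open>1/2\<close>. Reserving all of
  them costs more than any gain, once there are sufficiently many. If the algorithm packs one,
  an item of size \<open>1\<close> and huge value follows. If it rejects one, the exact complement of that
  item follows, also of value \<open>V\<close>; it does not fit together with any of the earlier, larger
  items, so the algorithm gets at most \<open>V\<close> against \<open>2 * V\<close>.
\<close>

section \<open>Bounds on the optimum and on the gain\<close>

lemma opt_gain_ge:
  assumes "I \<subseteq> {..<length S}" "total_size S I \<le> 1"
  shows "total_value S I \<le> opt_gain S"
proof -
  have "finite (total_value S ` Pow {..<length S})" by simp
  then have "finite {total_value S I | I. I \<subseteq> {..<length S} \<and> total_size S I \<le> 1}"
    by (rule rev_finite_subset) auto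
  then show ?thesis unfolding opt_gain_def using assms by (intro Max_ge) auto
qed

lemma positions_subset: "positions d A S \<subseteq> {..<length S}"
  by (auto simp: positions_def)

lemma chosen_subset:
  assumes "online_algorithm A" "request_sequence S"
  shows "packed A S \<union> finish A S \<subseteq> packed A S \<union> reserved A S"
  using assms unfolding online_algorithm_def by auto

text \<open>All sizes are positive, so the capacity bound passes to any two of the finally packed
  items. Each adversary with several large items uses this to show that at most one item is
  packed.\<close>

lemma chosen_pair_fits:
  assumes "online_algorithm A" and S: "request_sequence S"
    and i: "i \<in> packed A S \<union> finish A S" and j: "j \<in> packed A S \<union> finish A S"
    and "i \<noteq> j"
  shows "item_size (S ! i) + item_size (S ! j) \<le> 1"
proof -
  let ?I = "packed A S \<union> finish A S"
  have sub: "?I \<subseteq> {..<length S}"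
    using chosen_subset[OF assms(1,2)] positions_subset by blast
  have "total_size S {i, j} \<le> total_size S ?I"
    unfolding total_size_def
  proof (rule sum_mono2)
    show "finite ?I" using sub finite_subset by blast
    show "{i, j} \<subseteq> ?I" using i j by blast
    fix k assume "k \<in> ?I - {i, j}"
    then have "S ! k \<in> set S" using sub by auto
    then show "0 \<le> item_size (S ! k)" using S unfolding request_sequence_def by fastforce
  qed
  also have "\<dots> \<le> 1" using assms(1,2) unfolding online_algorithm_def by blast
  finally show ?thesis using \<open>i \<noteq> j\<close> by (simp add: total_size_def)
qed

text \<open>The first premise says that at most one item is finally packed. The reservation cost
  stays explicit because it is what defeats an algorithm that reserves everything.\<close>

lemma gain_le_single_value:
  assumes "\<And>i j. i \<in> packed A S \<union> finish A S \<Longrightarrow> j \<in> packed A S \<union> finish A S \<Longrightarrow> i = j"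
    and "\<And>i. i \<in> packed A S \<union> finish A S \<Longrightarrow> item_value (S ! i) \<le> V" and "0 \<le> V"
  shows "gain \<alpha> A S \<le> V - (\<Sum>i\<in>reserved A S. \<alpha> * item_size (S ! i))"
proof (cases "packed A S \<union> finish A S = {}")
  case True
  then show ?thesis using assms(3) by (simp add: gain_def total_value_def)
next
  case False
  then obtain i where "i \<in> packed A S \<union> finish A S" by blast
  moreover from this have "packed A S \<union> finish A S = {i}" using assms(1) by blast
  ultimately show ?thesis using assms(2)[of i] by (simp add: gain_def total_value_def)
qed

lemma gain_le_single_value_gross:
  assumes "\<And>i j. i \<in> packed A S \<union> finish A S \<Longrightarrow> j \<in> packed A S \<union> finish A S \<Longrightarrow> i = j"
    and "\<And>i. i \<in> packed A S \<union> finish A S \<Longrightarrow> item_value (S ! i) \<le> V" and "0 \<le> V"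
    and "request_sequence S" and "0 \<le> \<alpha>"
  shows "gain \<alpha> A S \<le> V"
proof -
  have "0 \<le> (\<Sum>i\<in>reserved A S. \<alpha> * item_size (S ! i))"
  proof (intro sum_nonneg mult_nonneg_nonneg)
    fix i assume "i \<in> reserved A S"
    then have "S ! i \<in> set S" using positions_subset by fastforce
    then show "0 \<le> item_size (S ! i)" using assms(4) unfolding request_sequence_def by fastforce
  qed (rule assms(5))
  moreover have "gain \<alpha> A S \<le> V - (\<Sum>i\<in>reserved A S. \<alpha> * item_size (S ! i))"
    by (rule gain_le_single_value) (fact assms)+
  ultimately show ?thesis by linarith
qed

section \<open>The decreasing sequence of large items\<close>

text \<open>The offset 4 starts the sizes at 3/4: staying below 1 leaves every complement a positive
  size, and staying above 1/2 keeps any two items from fitting together.\<close>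

definition large_size :: "nat \<Rightarrow> real" where
  "large_size i = 1/2 + 1 / (4 + real i)"

definition large_items :: "real \<Rightarrow> nat \<Rightarrow> item list" where
  "large_items V n = map (\<lambda>i. Item (large_size i) V) [0..<n]"

lemma large_size_gt: "1/2 < large_size i"
  by (simp add: large_size_def)

lemma large_size_less_1: "large_size i < 1"
  by (simp add: large_size_def field_simps)

lemma large_size_strict_antimono: "i < j \<Longrightarrow> large_size j < large_size i"
  by (simp add: large_size_def field_simps)

lemma length_large_items [simp]: "length (large_items V n) = n"
  by (simp add: large_items_def)

lemma nth_large_items [simp]: "i < n \<Longrightarrow> large_items V n ! i = Item (large_size i) V"
  by (simp add: large_items_def)

lemma take_large_items: "i \<le> n \<Longrightarrow> take i (large_items V n) = large_items V i"
  by (simp add: large_items_def take_map)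

lemma request_sequence_large_items: "0 < V \<Longrightarrow> request_sequence (large_items V n)"
  using large_size_gt large_size_less_1
  by (fastforce simp: request_sequence_def large_items_def intro: less_imp_le less_trans[of 0 "1/2"])

lemma request_sequence_append_large:
  "0 < V \<Longrightarrow> 0 < s \<Longrightarrow> s \<le> 1 \<Longrightarrow> 0 < v \<Longrightarrow> request_sequence (large_items V n @ [Item s v])"
  using request_sequence_large_items[of V n] by (auto simp: request_sequence_def)

section \<open>Adversaries for the possible reactions\<close>

text \<open>Only one item fits, while each of the \<open>n\<close> reservations costs more than
  \<open>\<alpha> / 2\<close>; the optimum packs the first item for free.\<close>

lemma adversary_all_reserved:
  assumes A: "online_algorithm A" and "0 < \<alpha>" "0 \<le> c" "0 < V"
    and "0 < n" and n: "c * (V - n * \<alpha> / 2) + \<beta> < V"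
    and res: "\<And>i. i < n \<Longrightarrow> decide A (large_items V (Suc i)) = Reserve"
  shows "c * gain \<alpha> A (large_items V n) + \<beta> < opt_gain (large_items V n)"
proof -
  let ?S = "large_items V n"
  have S: "request_sequence ?S" using request_sequence_large_items \<open>0 < V\<close> by blast
  have R: "reserved A ?S = {..<n}"
    using res by (auto simp: positions_def take_large_items)
  have sub: "i < n" if "i \<in> packed A ?S \<union> finish A ?S" for i
    using that chosen_subset[OF A S] positions_subset[of _ A ?S] by fastforce
  have "gain \<alpha> A ?S \<le> V - (\<Sum>i\<in>reserved A ?S. \<alpha> * item_size (?S ! i))"
  proof (rule gain_le_single_value)
    fix i j assume ij: "i \<in> packed A ?S \<union> finish A ?S" "j \<in> packed A ?S \<union> finish A ?S"
    show "i = j"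
    proof (rule ccontr)
      assume "i \<noteq> j"
      from chosen_pair_fits[OF A S ij this] sub[OF ij(1)] sub[OF ij(2)] show False
        using large_size_gt[of i] large_size_gt[of j] by simp
    qed
  qed (use sub \<open>0 < V\<close> in auto)
  moreover have "(\<Sum>i<n. \<alpha> * (1/2)) \<le> (\<Sum>i<n. \<alpha> * item_size (?S ! i))"
    using large_size_gt \<open>0 < \<alpha>\<close> by (intro sum_mono mult_left_mono) (auto intro: less_imp_le)
  ultimately have "gain \<alpha> A ?S \<le> V - n * \<alpha> / 2" by (simp add: R)
  then have "c * gain \<alpha> A ?S \<le> c * (V - n * \<alpha> / 2)"
    using \<open>0 \<le> c\<close> by (rule mult_left_mono)
  moreover have "total_value ?S {0} \<le> opt_gain ?S"
    using \<open>0 < n\<close> large_size_less_1[of 0] by (intro opt_gain_ge) (auto simp: total_size_def)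
  then have "V \<le> opt_gain ?S" using \<open>0 < n\<close> by (simp add: total_value_def)
  ultimately show ?thesis using n by linarith
qed

text \<open>The packed item fills more than half of the knapsack, which blocks every other large
  item as well as the final item of size 1.\<close>

lemma adversary_packed:
  assumes A: "online_algorithm A" and "0 < \<alpha>" "0 \<le> c" "0 < V" "0 < \<beta>"
    and pack: "decide A (large_items V (Suc i)) = Pack"
  shows "\<exists>S. request_sequence S \<and> c * gain \<alpha> A S + \<beta> < opt_gain S"
proof -
  \<comment> \<open>The final item alone must beat \<open>c * V + \<beta>\<close>, as the gain is at
    most \<open>V\<close>.\<close>
  define M where "M = c * V + \<beta> + 1"
  have "0 \<le> c * V" using assms by simp
  then have "0 < M" using \<open>0 < \<beta>\<close> by (simp add: M_def)
  define S where "S = large_items V (Suc i) @ [Item 1 M]"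
  have S: "request_sequence S"
    unfolding S_def using \<open>0 < V\<close> \<open>0 < M\<close> by (intro request_sequence_append_large) auto
  have nth: "S ! j = (if j < Suc i then Item (large_size j) V else Item 1 M)" if "j < length S" for j
    using that by (auto simp: S_def nth_append)
  have len: "length S = Suc (Suc i)" by (simp add: S_def)
  have i: "i \<in> packed A S \<union> finish A S"
    using pack len by (simp add: positions_def S_def take_large_items)
  have sub: "j < length S" if "j \<in> packed A S \<union> finish A S" for j
    using that chosen_subset[OF A S] positions_subset[of _ A S] by fastforce
  have only: "j = i" if j: "j \<in> packed A S \<union> finish A S" for j
  proof (rule ccontr)
    assume "j \<noteq> i"
    from chosen_pair_fits[OF A S j i this] sub[OF j] sub[OF i] show False
      using large_size_gt[of i] large_size_gt[of j] by (simp add: nth split: if_splits)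
  qed
  have "gain \<alpha> A S \<le> V"
  proof (rule gain_le_single_value_gross)
    show "j = k" if "j \<in> packed A S \<union> finish A S" "k \<in> packed A S \<union> finish A S" for j k
      using only that by metis
    show "item_value (S ! j) \<le> V" if "j \<in> packed A S \<union> finish A S" for j
      using only[OF that] len by (simp add: nth)
  qed (use S assms in auto)
  then have "c * gain \<alpha> A S \<le> c * V" using \<open>0 \<le> c\<close> by (rule mult_left_mono)
  moreover have "total_value S {Suc i} \<le> opt_gain S"
    by (rule opt_gain_ge) (auto simp: len total_size_def nth)
  then have "M \<le> opt_gain S" by (simp add: total_value_def nth len)
  ultimately have "c * gain \<alpha> A S + \<beta> < opt_gain S" by (simp add: M_def)
  with S show ?thesis by blast
qed

lemma adversary_rejected:
  assumes A: "online_algorithm A" and "0 < \<alpha>" "0 \<le> c" "0 < V" and V: "c * V + \<beta> < 2 * V"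
    and rej: "decide A (large_items V (Suc i)) = Reject"
  shows "\<exists>S. request_sequence S \<and> c * gain \<alpha> A S + \<beta> < opt_gain S"
proof -
  define S where "S = large_items V (Suc i) @ [Item (1 - large_size i) V]"
  have S: "request_sequence S"
    unfolding S_def using \<open>0 < V\<close> large_size_less_1[of i] large_size_gt[of i]
    by (intro request_sequence_append_large) auto
  have nth: "S ! j = Item (if j < Suc i then large_size j else 1 - large_size i) V"
    if "j < length S" for j
    using that by (auto simp: S_def nth_append)
  have len: "length S = Suc (Suc i)" by (simp add: S_def)
  have "i \<notin> packed A S \<union> reserved A S"
    using rej by (simp add: positions_def S_def take_large_items)
  then have i: "i \<notin> packed A S \<union> finish A S" using chosen_subset[OF A S] by blast
  have sub: "j < length S" if "j \<in> packed A S \<union> finish A S" for j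
    using that chosen_subset[OF A S] positions_subset[of _ A S] by fastforce
  have no_pair: False
    if jk: "j \<in> packed A S \<union> finish A S" "k \<in> packed A S \<union> finish A S" "j < k" for j k
  proof -
    have "k \<noteq> i" "j \<noteq> i" using i jk by auto
    \<comment> \<open>Thus item \<open>j\<close> is strictly larger than item \<open>i\<close>, so
      it overflows with the complement of item \<open>i\<close>; if \<open>k\<close> is a large item
      instead, both sizes exceed 1/2.\<close>
    then have "j < i" using sub[OF jk(2)] len \<open>j < k\<close> by linarith
    then show False
      using chosen_pair_fits[OF A S jk(1,2)] sub[OF jk(1)] sub[OF jk(2)] \<open>j < k\<close>
        large_size_gt[of j] large_size_gt[of k] large_size_strict_antimono[of j i]
      by (simp add: nth split: if_splits)
  qed
  have "gain \<alpha> A S \<le> V"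
  proof (rule gain_le_single_value_gross)
    show "j = k" if "j \<in> packed A S \<union> finish A S" "k \<in> packed A S \<union> finish A S" for j k
      using no_pair that by (metis linorder_neqE_nat)
    show "item_value (S ! j) \<le> V" if "j \<in> packed A S \<union> finish A S" for j
      using sub[OF that] by (simp add: nth)
  qed (use S assms in auto)
  then have "c * gain \<alpha> A S \<le> c * V" using \<open>0 \<le> c\<close> by (rule mult_left_mono)
  \<comment> \<open>The rejected item and its complement have total size exactly 1.\<close>
  moreover have "total_value S {i, Suc i} \<le> opt_gain S"
    by (rule opt_gain_ge) (auto simp: len total_size_def nth)
  then have "2 * V \<le> opt_gain S" by (simp add: total_value_def nth len)
  ultimately have "c * gain \<alpha> A S + \<beta> < opt_gain S" using V by linarith
  with S show ?thesis by blast
qed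

text \<open>For negative \<open>c\<close>, a negative gain works against the adversary; with a single request it
  is bounded.\<close>

lemma adversary_nonpos_factor:
  assumes A: "online_algorithm A" and "0 < \<alpha>" "c \<le> 0" "0 < \<beta>"
  shows "\<exists>S. request_sequence S \<and> c * gain \<alpha> A S + \<beta> < opt_gain S"
proof -
  \<comment> \<open>The gain on one item of size 1 is at least \<open>- \<alpha>\<close>, so
    \<open>c\<close> times the gain is at most \<open>- c * \<alpha>\<close>.\<close>
  define V where "V = \<beta> - c * \<alpha> + 1"
  have "c * \<alpha> \<le> 0" using assms by (simp add: mult_nonpos_nonneg)
  then have "0 < V" using \<open>0 < \<beta>\<close> by (simp add: V_def)
  let ?S = "[Item 1 V]"
  have S: "request_sequence ?S" using \<open>0 < V\<close> by (simp add: request_sequence_def)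
  have sub: "packed A ?S \<union> finish A ?S \<subseteq> {0}"
    using chosen_subset[OF A S] positions_subset[of _ A ?S] by fastforce
  have "0 \<le> total_value ?S (packed A ?S \<union> finish A ?S)"
    unfolding total_value_def using sub \<open>0 < V\<close> by (intro sum_nonneg) auto
  moreover have "(\<Sum>i\<in>reserved A ?S. \<alpha> * item_size (?S ! i)) \<le> (\<Sum>i\<in>{0}. \<alpha> * item_size (?S ! i))"
    using positions_subset[of Reserve A ?S] \<open>0 < \<alpha>\<close> by (intro sum_mono2) auto
  ultimately have "- \<alpha> \<le> gain \<alpha> A ?S" by (simp add: gain_def)
  then have "c * gain \<alpha> A ?S \<le> c * (- \<alpha>)" using \<open>c \<le> 0\<close> by (rule mult_left_mono_neg)
  moreover have "total_value ?S {0} \<le> opt_gain ?S"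
    by (rule opt_gain_ge) (auto simp: total_size_def)
  then have "V \<le> opt_gain ?S" by (simp add: total_value_def)
  ultimately have "c * gain \<alpha> A ?S + \<beta> < opt_gain ?S" by (simp add: V_def)
  with S show ?thesis by blast
qed

lemma adversary_exists:
  assumes A: "online_algorithm A" and "0 < \<alpha>" "c < 2" "0 < \<beta>"
  shows "\<exists>S. request_sequence S \<and> c * gain \<alpha> A S + \<beta> < opt_gain S"
proof (cases "c \<le> 0")
  case True
  then show ?thesis using adversary_nonpos_factor assms by blast
next
  case False
  \<comment> \<open>With this value, \<open>2 * V\<close> exceeds \<open>c * V + \<beta>\<close> by
    exactly 1.\<close>
  define V where "V = (\<beta> + 1) / (2 - c)"
  have "0 < V" using assms by (simp add: V_def)
  have "(2 - c) * V = \<beta> + 1" using \<open>c < 2\<close> by (simp add: V_def)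
  then have V: "c * V + \<beta> < 2 * V" by (simp add: algebra_simps)
  \<comment> \<open>Each reservation lowers \<open>c\<close> times the bound on the gain by
    \<open>d\<close>; the choice of \<open>n\<close> makes
    \<open>c * (V - n * \<alpha> / 2) + \<beta>\<close> negative.\<close>
  define d where "d = c * \<alpha> / 2"
  have "0 < d" using False \<open>0 < \<alpha>\<close> by (simp add: d_def)
  then obtain n :: nat where n': "c * V + \<beta> < n * d"
    using reals_Archimedean3 by blast
  have "0 < c * V + \<beta>" using False \<open>0 < V\<close> \<open>0 < \<beta>\<close> by (simp add: add_pos_pos)
  with n' have "0 < n" by (intro gr0I) auto
  have n: "c * (V - n * \<alpha> / 2) + \<beta> < V" using n' \<open>0 < V\<close> by (simp add: d_def algebra_simps)
  show ?thesis
  proof (cases "\<forall>i<n. decide A (large_items V (Suc i)) = Reserve")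
    case True
    then show ?thesis
      using adversary_all_reserved[OF A \<open>0 < \<alpha>\<close> _ \<open>0 < V\<close> \<open>0 < n\<close> n] False
        request_sequence_large_items[OF \<open>0 < V\<close>] by force
  next
    case not_all: False
    \<comment> \<open>Any such \<open>i\<close> serves, not just the least: the two adversaries work
      whatever was decided on the earlier items.\<close>
    then obtain i where "decide A (large_items V (Suc i)) \<noteq> Reserve" by blast
    then consider "decide A (large_items V (Suc i)) = Pack"
      | "decide A (large_items V (Suc i)) = Reject"
      using decision.exhaust by blast
    then show ?thesis
      using adversary_packed[OF A \<open>0 < \<alpha>\<close> _ \<open>0 < V\<close> \<open>0 < \<beta>\<close>]
        adversary_rejected[OF A \<open>0 < \<alpha>\<close> _ \<open>0 < V\<close> V] False
      by cases auto
  qed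
qed

theorem theorem2:
  fixes \<alpha> :: real
  assumes "0 < \<alpha>" and "\<alpha> \<le> 1"
  shows "(\<forall>c<2. \<not> (\<exists>A. online_algorithm A \<and> nonstrictly_competitive \<alpha> c A)) \<and>
    (\<forall>A c \<beta>. online_algorithm A \<longrightarrow> c < 2 \<longrightarrow> 0 < \<beta> \<longrightarrow>
      (\<exists>S. request_sequence S \<and> opt_gain S > c * gain \<alpha> A S + \<beta>))"
  \<comment> \<open>A constant \<open>\<beta>\<close> witnessing competitiveness is refuted by the
    sequence built for that same \<open>\<beta>\<close>.\<close>
  using adversary_exists[OF _ \<open>0 < \<alpha>\<close>] unfolding nonstrictly_competitive_def
  by (meson not_le)

end
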